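(* Let $p\ge1$, $\sigma>0$ and let $P$ be a probability distribution on $\mathbb{R}^p$. The distribution enlarged $\sigma$-simplicial depth $d_{P_\sigma}(\cdot;P)$ satisfies: (i) (affine invariance) for every nonsingular $p\times p$ matrix $A$, every $b\in\mathbb{R}^p$ and every $x\in\mathbb{R}^p$, the distribution enlarged $\sigma$-simplicial depth of $Ax+b$ with respect to the distribution of $AX+b$, where $X\sim P$, equals $d_{P_\sigma}(x;P)$; (ii) (vanishing at infinity) $d_{P_\sigma}(x;P)\to0$ as $\|x\|\to\infty$; (iii) $x\mapsto d_{P_\sigma}(x;P)$ is upper semicontinuous on $\mathbb{R}^p$. Additionally, (iv) if $P$ is smooth, then $x\mapsto d_{P_\sigma}(x;P)$ is continuous on $\mathbb{R}^p$. Furthermore, if $P$ is smooth and centrally symmetric about $\mu\in\mathbb{R}^p$, then (v) (maximality at the center) $d_{P_\sigma}(\mu;P)=\sup_{x\in\mathbb{R}^p}d_{P_\sigma}(x;P)$; and (vi) (monotonicity along rays) for every $u\in\mathbb{R}^p$, the function $t\mapsto d_{P_\sigma}(\mu+tu;P)$ is nonincreasing on $[0,\infty)$.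
   Context: $\triangle[x_1,\dots,x_{p+1}]$ denotes the closed simplex (convex hull) with vertices $x_1,\dots,x_{p+1}\in\mathbb{R}^p$, and $\mathbf{I}$ is the indicator function. Given a distribution $P$ on $\mathbb{R}^p$ and $\sigma>0$, the $\sigma$-transformation $P_\sigma$ of $P$ is the distribution of $\sigma(X_1-\bar X)+\bar X$, where $X_1,\dots,X_{p+1}$ are i.i.d. with distribution $P$ and $\bar X=\frac1{p+1}\sum_{j=1}^{p+1}X_j$. The distribution enlarged $\sigma$-simplicial depth of $x\in\mathbb{R}^p$ with respect to $P$ is $d_{P_\sigma}(x;P):=\int\mathbf{I}(x\in\triangle[x_1,\dots,x_{p+1}])\,dP_\sigma(x_1)\cdots dP_\sigma(x_{p+1})$. A distribution $P$ on $\mathbb{R}^p$ is smooth if $P(L)=0$ for every (affine) hyperplane $L\subset\mathbb{R}^p$. $P$ is centrally symmetric about $\mu$ if $X-\mu$ and $\mu-X$ are identically distributed for $X\sim P$. *)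

theory Defs
  imports "HOL-Probability.Probability"
begin

text \<open>The dimension \<open>p\<close> is \<open>CARD('n)\<close>. A family of \<open>p + 1\<close> points is a function on
  \<open>{..CARD('n)} = {0, \<dots>, p}\<close>, so the first point is \<open>X 0\<close>.\<close>

abbreviation iid_sample :: "(real^'n) measure \<Rightarrow> (nat \<Rightarrow> real^'n) measure" where
  "iid_sample P \<equiv> Pi\<^sub>M {..CARD('n)} (\<lambda>_. P)"

definition sample_mean :: "(nat \<Rightarrow> real^'n) \<Rightarrow> real^'n" where
  "sample_mean X = (\<Sum>j\<le>CARD('n). X j) /\<^sub>R real (CARD('n) + 1)"

definition sigma_transformation :: "real \<Rightarrow> (real^'n) measure \<Rightarrow> (real^'n) measure" where
  "sigma_transformation \<sigma> P =
     distr (iid_sample P) borel (\<lambda>X. \<sigma> *\<^sub>R (X 0 - sample_mean X) + sample_mean X)"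

definition enlarged_simplicial_depth :: "real \<Rightarrow> (real^'n) measure \<Rightarrow> real^'n \<Rightarrow> real" where
  "enlarged_simplicial_depth \<sigma> P x =
     (\<integral>X. indicator (convex hull (X ` {..CARD('n)})) x \<partial>iid_sample (sigma_transformation \<sigma> P))"

definition smooth_distribution :: "(real^'n) measure \<Rightarrow> bool" where
  "smooth_distribution P \<longleftrightarrow> (\<forall>a b. a \<noteq> 0 \<longrightarrow> emeasure P {x. a \<bullet> x = b} = 0)"

definition centrally_symmetric_about :: "(real^'n) measure \<Rightarrow> real^'n \<Rightarrow> bool" where
  "centrally_symmetric_about P \<mu> \<longleftrightarrow>
     distr P borel (\<lambda>x. x - \<mu>) = distr P borel (\<lambda>x. \<mu> - x)"

definition upper_semicontinuous :: "('a::topological_space \<Rightarrow> real) \<Rightarrow> bool" where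
  "upper_semicontinuous f \<longleftrightarrow> (\<forall>x c. f x < c \<longrightarrow> (\<forall>\<^sub>F y in nhds x. f y < c))"

end

theory Submission
  imports Defs
begin

text \<open>The depth with respect to \<open>P\<close> is the ordinary simplicial depth with respect to
  \<open>Q = P\<^sub>\<sigma>\<close>, and \<open>Q\<close> inherits what is assumed of \<open>P\<close>: the
  \<open>\<sigma>\<close>-transformation commutes with affine maps, so it preserves central symmetry, and
  \<open>X\<^sub>1\<close> enters \<open>\<sigma>(X\<^sub>1 - mean) + mean\<close> with a positive coefficient, so
  smoothness passes from \<open>P\<close> to \<open>Q\<close>. Everything is therefore proved for the simplicial
  depth of a probability distribution \<open>Q\<close>.

  Affine invariance holds because affine bijections map simplices to simplices. A simplex that
  covers \<open>x\<close> has a vertex of norm at least \<open>norm x\<close>, which gives the limit at infinity by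
  dominated convergence. Simplices are closed, which gives upper semicontinuity. If \<open>Q\<close> is
  smooth, then for a fixed \<open>x\<close> the vectors \<open>X\<^sub>j - x\<close>, with any one index left out,
  are almost surely linearly independent (\<open>AE_sample_independent\<close>). In that case \<open>x\<close> is
  not on the frontier of the random simplex (\<open>not_in_frontier_simplex\<close>), so its indicator is
  continuous at \<open>x\<close> and dominated convergence gives continuity of the depth.

  The behaviour along rays rests on an exact count. Translate the centre to \<open>0\<close>. Since
  \<open>X\<^sub>j\<close> and \<open>-X\<^sub>j\<close> have the same distribution, the depth of \<open>x\<close> is the
  expectation of the number of sign patterns \<open>\<epsilon>\<close> for which \<open>x\<close> lies in the simplex with
  vertices \<open>\<epsilon>\<^sub>j X\<^sub>j\<close>, divided by \<open>2\<^bsup>p+1\<^esup>\<close>. For almost every sample this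
  number is \<open>2\<close> if \<open>x\<close> lies in the symmetric convex body
  \<open>K = {\<Sum> z\<^sub>j X\<^sub>j | \<Sum> \<bar>z\<^sub>j\<bar> \<le> 1}\<close> and \<open>0\<close> otherwise
  (\<open>signed_simplices.card_signs\<close>). The reason is that the \<open>p + 1\<close> vectors satisfy a single
  linear relation \<open>\<Sum> c\<^sub>j X\<^sub>j = 0\<close>, so the representations of \<open>x\<close> form a line
  \<open>z + k c\<close>. A covering sign pattern corresponds to a value of \<open>k\<close> with
  \<open>\<Sum> \<bar>z\<^sub>j + k c\<^sub>j\<bar> = 1\<close>. The left side is a convex function of \<open>k\<close> that
  tends to infinity in both directions and, in general position, has non-zero slope at level
  \<open>1\<close>; hence it takes the value \<open>1\<close> twice or never. As \<open>K\<close> is star-shaped about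
  \<open>0\<close>, the count cannot increase along a ray from the centre, and neither can the depth;
  maximality at the centre is a special case.\<close>

definition simplicial_depth :: "(real^'n) measure \<Rightarrow> real^'n \<Rightarrow> real" where
  "simplicial_depth Q x =
     (\<integral>X. indicator (convex hull (X ` {..CARD('n)})) x \<partial>iid_sample Q)"

lemma enlarged_simplicial_depth_eq:
  "enlarged_simplicial_depth \<sigma> P = simplicial_depth (sigma_transformation \<sigma> P)"
  by (rule ext) (simp add: enlarged_simplicial_depth_def simplicial_depth_def)

section \<open>Membership in a simplex\<close>

lemma in_convex_hull_image_iff:
  fixes X :: "'i \<Rightarrow> 'a::real_vector"
  assumes "finite I"
  shows "x \<in> convex hull (X ` I) \<longleftrightarrow>
    (\<exists>w. (\<forall>i\<in>I. 0 \<le> w i) \<and> sum w I = 1 \<and> (\<Sum>i\<in>I. w i *\<^sub>R X i) = x)" (is "_ \<longleftrightarrow> ?R x")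
proof
  assume x: "x \<in> convex hull (X ` I)"
  have "convex hull (X ` I) \<subseteq> Collect ?R"
  proof (rule hull_minimal)
    show "X ` I \<subseteq> Collect ?R"
    proof clarsimp
      fix i assume i: "i \<in> I"
      show "?R (X i)"
        by (rule exI[of _ "\<lambda>j. if j = i then 1 else 0"])
          (use i assms in \<open>auto simp: if_distrib[of "\<lambda>c. c *\<^sub>R _"] cong: if_cong\<close>)
    qed
    show "convex (Collect ?R)"
    proof (rule convexI)
      fix y z and u v :: real
      assume "y \<in> Collect ?R" "z \<in> Collect ?R" and uv: "0 \<le> u" "0 \<le> v" "u + v = 1"
      then obtain w w' where w: "\<forall>i\<in>I. 0 \<le> w i" "sum w I = 1" "(\<Sum>i\<in>I. w i *\<^sub>R X i) = y"
        and w': "\<forall>i\<in>I. 0 \<le> w' i" "sum w' I = 1" "(\<Sum>i\<in>I. w' i *\<^sub>R X i) = z"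
        by auto
      have "(\<Sum>i\<in>I. (u * w i + v * w' i) *\<^sub>R X i) = u *\<^sub>R y + v *\<^sub>R z"
        by (simp add: w(3)[symmetric] w'(3)[symmetric] scaleR_sum_right scaleR_add_left sum.distrib)
      moreover have "(\<Sum>i\<in>I. u * w i + v * w' i) = 1"
        using w w' uv by (simp add: sum.distrib flip: sum_distrib_left)
      ultimately show "u *\<^sub>R y + v *\<^sub>R z \<in> Collect ?R"
        using w w' uv by (auto intro!: exI[of _ "\<lambda>i. u * w i + v * w' i"])
    qed
  qed
  with x show "?R x" by auto
next
  assume "?R x"
  then show "x \<in> convex hull (X ` I)"
    using assms by (auto intro!: convex_sum simp: hull_inc)
qed

text \<open>A point outside a polytope is strictly separated from it, and the separating directions form an
  open set, so countably many half-spaces decide membership. This is what makes the event that a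
  random simplex covers \<open>x\<close> measurable.\<close>

lemma in_convex_hull_iff_countable_halfspaces:
  fixes X :: "'i \<Rightarrow> 'a::euclidean_space"
  assumes I: "finite I" and D: "\<And>U. open U \<Longrightarrow> U \<noteq> {} \<Longrightarrow> \<exists>a\<in>D. a \<in> U"
  shows "x \<in> convex hull (X ` I) \<longleftrightarrow> (\<forall>a\<in>D. \<exists>i\<in>I. a \<bullet> x \<le> a \<bullet> X i)"
proof
  assume x: "x \<in> convex hull (X ` I)"
  show "\<forall>a\<in>D. \<exists>i\<in>I. a \<bullet> x \<le> a \<bullet> X i"
  proof (rule ballI, rule ccontr)
    fix a assume "\<not> (\<exists>i\<in>I. a \<bullet> x \<le> a \<bullet> X i)"
    then have "X ` I \<subseteq> {y. a \<bullet> y < a \<bullet> x}"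
      by (auto simp: not_le)
    then have "convex hull (X ` I) \<subseteq> {y. a \<bullet> y < a \<bullet> x}"
      by (intro hull_minimal) (auto simp: convex_halfspace_lt)
    with x show False by auto
  qed
next
  assume R: "\<forall>a\<in>D. \<exists>i\<in>I. a \<bullet> x \<le> a \<bullet> X i"
  show "x \<in> convex hull (X ` I)"
  proof (rule ccontr)
    assume "x \<notin> convex hull (X ` I)"
    moreover have "closed (convex hull (X ` I))"
      using I by (intro compact_imp_closed compact_convex_hull finite_imp_compact) auto
    ultimately obtain a b where ab: "a \<bullet> x < b" "\<forall>y\<in>convex hull (X ` I). b < a \<bullet> y"
      using separating_hyperplane_closed_point convex_convex_hull by metis
    let ?U = "\<Inter>i\<in>I. {a. a \<bullet> X i < a \<bullet> x}"
    have "open ?U"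
      using I by (intro open_INT ballI open_Collect_less continuous_intros) auto
    moreover have "- a \<in> ?U"
      using ab by (auto simp: hull_inc intro: less_trans)
    ultimately obtain a' where "a' \<in> D" "a' \<in> ?U"
      using D[of ?U] by blast
    with R show False
      by (force simp: not_le[symmetric])
  qed
qed

lemma countable_dense_directions:
  obtains D :: "'a::euclidean_space set"
  where "countable D" "\<And>U. open U \<Longrightarrow> U \<noteq> {} \<Longrightarrow> \<exists>a\<in>D. a \<in> U"
  using countable_dense_setE by blast

lemma measurable_in_convex_hull_sample:
  fixes Q :: "'a::euclidean_space measure"
  assumes [measurable_cong]: "sets Q = sets borel" and [measurable]: "finite I"
  shows "(\<lambda>X. indicator (convex hull (X ` I)) x :: real) \<in> borel_measurable (Pi\<^sub>M I (\<lambda>_. Q))"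
proof -
  obtain D :: "'a set" where D[measurable]: "countable D" and
     D': "\<And>U. open U \<Longrightarrow> U \<noteq> {} \<Longrightarrow> \<exists>a\<in>D. a \<in> U"
    by (rule countable_dense_directions) blast
  have "(\<lambda>X. indicator (convex hull (X ` I)) x :: real)
      = (\<lambda>X. if \<forall>a\<in>D. \<exists>i\<in>I. a \<bullet> x \<le> a \<bullet> X i then 1 else 0)"
    by (intro ext) (simp add: in_convex_hull_iff_countable_halfspaces[OF \<open>finite I\<close> D'] indicator_def)
  also have "\<dots> \<in> borel_measurable (Pi\<^sub>M I (\<lambda>_. Q))"
    by (measurable)
  finally show ?thesis .
qed

section \<open>General position of a sample from a smooth distribution\<close>

text \<open>Replacing one coordinate by an independent copy leaves the product distribution unchanged. Hence
  an almost sure property may be shown by freezing all coordinates but one.\<close>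

lemma AE_resample_coordinate:
  assumes Q: "prob_space Q" and "i \<in> I"
    and [measurable]: "Measurable.pred (Pi\<^sub>M I (\<lambda>_. Q)) R"
    and AE: "AE X in Pi\<^sub>M I (\<lambda>_. Q). AE w in Q. R (X(i := w))"
  shows "AE X in Pi\<^sub>M I (\<lambda>_. Q). R X"
proof -
  let ?P = "Pi\<^sub>M I (\<lambda>_. Q)"
  interpret Q: prob_space Q by fact
  interpret PI: prob_space ?P by (intro prob_space_PiM Q)
  interpret pair_sigma_finite Q ?P ..
  have [simp]: "insert i I = I" using \<open>i \<in> I\<close> by auto
  have upd[measurable]: "(\<lambda>(w, X). X(i := w)) \<in> Q \<Otimes>\<^sub>M ?P \<rightarrow>\<^sub>M ?P"
    using \<open>i \<in> I\<close> by (auto intro!: measurable_fun_upd[where J=I] simp: split_beta')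
  have "?P = distr (Q \<Otimes>\<^sub>M ?P) ?P (\<lambda>(w, X). X(i := w))"
    using distr_pair_PiM_eq_PiM[of I "\<lambda>_. Q" i] Q by simp
  moreover have "AE z in distr (Q \<Otimes>\<^sub>M ?P) ?P (\<lambda>(w, X). X(i := w)). R z"
  proof (subst AE_distr_iff)
    have "AE w in Q. AE X in ?P. R (X(i := w))"
      using AE by (subst AE_commute) measurable
    then show "AE z in Q \<Otimes>\<^sub>M ?P. R (case z of (w, X) \<Rightarrow> X(i := w))"
      by (intro AE_pair_measure) (simp_all add: pred_def[symmetric])
  qed (use upd in auto)
  ultimately show ?thesis by metis
qed

lemma AE_not_in_hyperplane:
  assumes "smooth_distribution Q" "sets Q = sets borel" "a \<noteq> 0"
  shows "AE w in Q. a \<bullet> w \<noteq> b"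
proof -
  have "space Q = UNIV" using assms(2) sets_eq_imp_space_eq by force
  moreover have "{x. a \<bullet> x = b} \<in> null_sets Q"
    using assms by (auto simp: smooth_distribution_def null_sets_def intro!: borel_closed closed_hyperplane)
  ultimately show ?thesis
    by (intro AE_I'[of "{x. a \<bullet> x = b}"]) auto
qed

lemma measurable_det [measurable]:
  fixes f :: "'a \<Rightarrow> 'n::finite \<Rightarrow> real^'n"
  assumes "\<And>k. (\<lambda>x. f x k) \<in> borel_measurable M"
  shows "(\<lambda>x. det (\<chi> k. f x k)) \<in> borel_measurable M"
proof -
  have *: "(\<lambda>x. f x k $ j) \<in> borel_measurable M" for k j
    using borel_measurable_inner[OF assms[of k] borel_measurable_const[of "axis j 1"]]
    by (simp add: inner_axis)
  show ?thesis
    unfolding det_def by (simp, intro borel_measurable_sum borel_measurable_times borel_measurable_prod * borel_measurable_const)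
qed

text \<open>The determinant is linear in each row, so its vanishing as a condition on one row describes a
  hyperplane (or the whole space).\<close>

lemma det_row_inner:
  fixes r :: "'n::finite \<Rightarrow> real^'n"
  obtains a where "\<And>v. det (\<chi> k. if k = i then v else r k) = a \<bullet> v"
proof -
  let ?L = "\<lambda>v. det (\<chi> k. if k = i then v else r k)"
  have "linear ?L"
  proof (rule linearI)
    show "?L (v + w) = ?L v + ?L w" for v w
      by (rule det_row_add)
    show "?L (c *\<^sub>R v) = c *\<^sub>R ?L v" for c v
      using det_row_mul[of i c "\<lambda>_. v" r] by (simp only: scalar_mult_eq_scaleR real_scaleR_def)
  qed
  then have "?L v = adjoint ?L 1 \<bullet> v" for v
    using adjoint_works[of ?L v 1] by (simp add: inner_commute)
  then show ?thesis by (rule that)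
qed

text \<open>The rows of the identity matrix are replaced one after the other by the random rows. Each
  replacement keeps the determinant non-zero almost surely: by the induction hypothesis the
  determinant is a non-zero linear functional of the row to be replaced, and smoothness excludes
  almost surely that the new row lands on the hyperplane where this functional vanishes.\<close>

lemma AE_det_sample_neq_0:
  fixes Q :: "(real^'n) measure" and x :: "real^'n"
  assumes Q: "prob_space Q" and sQ[measurable_cong]: "sets Q = sets borel" and smooth: "smooth_distribution Q"
    and g: "inj g" "range g \<subseteq> I" and e: "\<And>k. e k \<noteq> 0"
  shows "AE X in Pi\<^sub>M I (\<lambda>_. Q). det (\<chi> k. e (g k) *\<^sub>R X (g k) - x) \<noteq> 0"
proof -
  have gI[measurable]: "g k \<in> I" for k using g by auto
  have "AE X in Pi\<^sub>M I (\<lambda>_. Q). det (\<chi> k. if k \<in> S then e (g k) *\<^sub>R X (g k) - x else axis k 1) \<noteq> 0"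
    if "finite S" for S
    using that
  proof (induction S)
    case empty
    have "(\<chi> k. axis k 1) = (mat 1 :: real^'n^'n)"
      by (auto simp: vec_eq_iff mat_def axis_def)
    then show ?case by simp
  next
    case (insert i S)
    show ?case
    proof (rule AE_resample_coordinate[OF Q gI[of i]])
      show "Measurable.pred (Pi\<^sub>M I (\<lambda>_. Q))
         (\<lambda>X. det (\<chi> k. if k \<in> insert i S then e (g k) *\<^sub>R X (g k) - x else axis k 1) \<noteq> 0)"
        by measurable
      show "AE X in Pi\<^sub>M I (\<lambda>_. Q). AE w in Q. det (\<chi> k. if k \<in> insert i S
          then e (g k) *\<^sub>R (X(g i := w)) (g k) - x else axis k 1) \<noteq> 0"
        using insert.IH
      proof eventually_elim
        case (elim X)
        let ?r = "\<lambda>k. if k \<in> S then e (g k) *\<^sub>R X (g k) - x else axis k 1"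
        obtain a where a: "\<And>v. det (\<chi> k. if k = i then v else ?r k) = a \<bullet> v"
          by (rule det_row_inner[of i ?r]) blast
        have eq: "(\<chi> k. ?r k) = (\<chi> k. if k = i then axis i 1 else ?r k)"
          using insert.hyps by (simp add: vec_eq_iff)
        have "a \<bullet> axis i 1 \<noteq> 0"
          using elim unfolding eq a .
        then have "a \<noteq> 0" by auto
        then have "AE w in Q. (e (g i) *\<^sub>R a) \<bullet> w \<noteq> a \<bullet> x"
          by (intro AE_not_in_hyperplane smooth sQ) (use e in auto)
        then show "AE w in Q. det (\<chi> k. if k \<in> insert i S
            then e (g k) *\<^sub>R (X(g i := w)) (g k) - x else axis k 1) \<noteq> 0"
        proof eventually_elim
          case (elim w)
          have "(\<chi> k. if k \<in> insert i S then e (g k) *\<^sub>R (X(g i := w)) (g k) - x else axis k 1)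
             = (\<chi> k. if k = i then e (g i) *\<^sub>R w - x else ?r k)"
            using inj_eq[OF g(1)] insert.hyps by (simp add: vec_eq_iff)
          then show ?case
            using elim by (simp only: a) (simp add: inner_diff_right)
        qed
      qed
    qed
  qed
  from this[of UNIV] show ?thesis by simp
qed

text \<open>Stated for families rather than sets, so that two equal members count as a dependence; sample
  points may coincide.\<close>

definition independent_family :: "'i set \<Rightarrow> ('i \<Rightarrow> 'a::real_vector) \<Rightarrow> bool" where
  "independent_family J v \<longleftrightarrow> (\<forall>c. (\<Sum>j\<in>J. c j *\<^sub>R v j) = 0 \<longrightarrow> (\<forall>j\<in>J. c j = 0))"

lemma independent_family_cong:
  assumes "\<And>j. j \<in> J \<Longrightarrow> v j = v' j"
  shows "independent_family J v \<longleftrightarrow> independent_family J v'"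
  using assms by (simp add: independent_family_def cong: sum.cong)

lemma independent_family_iff_det:
  fixes v :: "'i \<Rightarrow> real^'n" and g :: "'n \<Rightarrow> 'i"
  assumes g: "bij_betw g UNIV J"
  shows "independent_family J v \<longleftrightarrow> det (\<chi> k. v (g k)) \<noteq> 0"
proof -
  let ?A = "\<chi> k. v (g k)"
  have J: "J = range g" and inj: "inj g" using g by (auto simp: bij_betw_def)
  have row: "row k ?A = v (g k)" for k by (simp add: row_def vec_eq_iff)
  have sum: "(\<Sum>j\<in>J. c j *\<^sub>R v j) = (\<Sum>k\<in>UNIV. c (g k) *\<^sub>R v (g k))" for c
    unfolding J by (subst sum.reindex[OF inj]) (simp add: o_def)
  have "det ?A \<noteq> 0 \<longleftrightarrow> (\<exists>B. ?A ** B = mat 1)"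
    using invertible_det_nz[of ?A] invertible_right_inverse[of ?A] by simp
  also have "\<dots> \<longleftrightarrow> (\<forall>c. (\<Sum>k\<in>UNIV. c k *\<^sub>R v (g k)) = 0 \<longrightarrow> (\<forall>k. c k = 0))"
    by (simp only: matrix_right_invertible_independent_rows row scalar_mult_eq_scaleR)
  also have "\<dots> \<longleftrightarrow> independent_family J v"
    unfolding independent_family_def sum
  proof safe
    fix c and j assume *: "\<forall>c. (\<Sum>k\<in>UNIV. c k *\<^sub>R v (g k)) = 0 \<longrightarrow> (\<forall>k. c k = 0)"
      "(\<Sum>k\<in>UNIV. c (g k) *\<^sub>R v (g k)) = 0" "j \<in> J"
    then show "c j = 0" using J by auto
  next
    fix c and k assume *: "\<forall>c. (\<Sum>k\<in>UNIV. c (g k) *\<^sub>R v (g k)) = 0 \<longrightarrow> (\<forall>j\<in>J. c j = 0)"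
      "(\<Sum>k\<in>UNIV. c k *\<^sub>R v (g k)) = 0"
    from spec[OF *(1), of "\<lambda>j. c (inv g j)"] *(2) show "c k = 0" using J inj by auto
  qed
  finally show ?thesis by simp
qed

lemma obtain_enumeration:
  assumes "finite J" "card J = CARD('n::finite)"
  obtains g :: "'n::finite \<Rightarrow> 'i" where "bij_betw g UNIV J"
  using finite_same_card_bij[of "UNIV :: 'n set" J] assms by auto

lemma independent_family_orthogonal:
  fixes v :: "'i \<Rightarrow> real^'n"
  assumes "independent_family J v" "finite J" "card J = CARD('n)" and a: "\<And>j. j \<in> J \<Longrightarrow> v j \<bullet> a = 0"
  shows "a = 0"
proof -
  obtain g :: "'n \<Rightarrow> 'i" where g: "bij_betw g UNIV J"
    using obtain_enumeration[of J] assms by metis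
  let ?A = "\<chi> k. v (g k)"
  have "invertible ?A"
    using assms(1) independent_family_iff_det[OF g] by (simp add: invertible_det_nz)
  moreover have "?A *v a = 0"
    using a bij_betwE[OF g] by (simp add: vec_eq_iff matrix_vector_mul_component)
  ultimately show ?thesis
    using matrix_left_invertible_ker[of ?A] invertible_left_inverse[of ?A] by blast
qed

lemma independent_family_spans:
  fixes v :: "'i \<Rightarrow> real^'n"
  assumes "independent_family J v" "finite J" "card J = CARD('n)"
  obtains c where "y = (\<Sum>j\<in>J. c j *\<^sub>R v j)"
proof -
  obtain g :: "'n \<Rightarrow> 'i" where g: "bij_betw g UNIV J"
    using obtain_enumeration[of J] assms by metis
  let ?A = "transpose (\<chi> k. v (g k))"
  have "invertible ?A"
    using assms(1) independent_family_iff_det[OF g] by (simp add: invertible_det_nz)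
  then obtain B where B: "?A ** B = mat 1"
    by (auto simp: invertible_right_inverse)
  define c where "c j = (B *v y) $ inv g j" for j
  have "y = ?A *v (B *v y)"
    by (simp add: matrix_vector_mul_assoc B)
  also have "\<dots> = (\<Sum>k\<in>UNIV. (B *v y) $ k *\<^sub>R v (g k))"
    by (simp add: matrix_mult_sum row_def vec_lambda_eta scalar_mult_eq_scaleR)
  also have "\<dots> = (\<Sum>k\<in>UNIV. c (g k) *\<^sub>R v (g k))"
    using g by (simp add: c_def bij_betw_def)
  also have "\<dots> = (\<Sum>j\<in>J. c j *\<^sub>R v j)"
    by (rule sum.reindex_bij_betw[OF g])
  finally show ?thesis by (rule that)
qed

text \<open>General position in the form used throughout: \<open>x\<close> and any \<open>p\<close> of the vertices are
  affinely independent. The factors \<open>e j\<close> are there for the sign patterns.\<close>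

lemma AE_sample_independent:
  fixes Q :: "(real^'n) measure" and x :: "real^'n"
  assumes Q: "prob_space Q" "sets Q = sets borel" "smooth_distribution Q" and e: "\<And>j. e j \<noteq> 0"
  shows "AE X in iid_sample Q. \<forall>i\<in>{..CARD('n)}.
    independent_family ({..CARD('n)} - {i}) (\<lambda>j. e j *\<^sub>R X j - x)"
proof (rule AE_finite_allI)
  fix i assume i: "i \<in> {..CARD('n)}"
  then obtain g :: "'n \<Rightarrow> nat" where g: "bij_betw g UNIV ({..CARD('n)} - {i})"
    using obtain_enumeration[of "{..CARD('n)} - {i}"] by auto
  have "AE X in iid_sample Q. det (\<chi> k. e (g k) *\<^sub>R X (g k) - x) \<noteq> 0"
    using Q e g by (intro AE_det_sample_neq_0) (auto simp: bij_betw_def)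
  then show "AE X in iid_sample Q. independent_family ({..CARD('n)} - {i}) (\<lambda>j. e j *\<^sub>R X j - x)"
    by (simp add: independent_family_iff_det[OF g])
qed simp

text \<open>A frontier point \<open>x\<close> has a supporting hyperplane, which contains every vertex with positive
  barycentric weight. If a weight vanishes, the remaining weights are a linear relation between
  \<open>p\<close> of the vectors \<open>X\<^sub>j - x\<close>; if none does, all these vectors lie in a hyperplane.
  Both contradict independence.\<close>

lemma not_in_frontier_simplex:
  fixes X :: "nat \<Rightarrow> real^'n"
  assumes indep: "\<And>i. i \<in> {..CARD('n)} \<Longrightarrow> independent_family ({..CARD('n)} - {i}) (\<lambda>j. X j - x)"
  shows "x \<notin> frontier (convex hull (X ` {..CARD('n)}))"
proof
  let ?I = "{..CARD('n)}" let ?S = "convex hull (X ` ?I)"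
  assume fr: "x \<in> frontier ?S"
  have "closed ?S"
    by (intro compact_imp_closed compact_convex_hull finite_imp_compact) auto
  with fr have x: "x \<in> ?S" "x \<notin> interior ?S"
    by (auto simp: frontier_def)
  obtain a where a: "a \<noteq> 0" "\<And>y. y \<in> ?S \<Longrightarrow> a \<bullet> x \<le> a \<bullet> y"
  proof (cases "interior ?S = {}")
    case True
    with empty_interior_subset_hyperplane[of ?S] obtain a b where "a \<noteq> 0" "?S \<subseteq> {y. a \<bullet> y = b}"
      by (metis convex_convex_hull)
    with x(1) have "a \<bullet> x = a \<bullet> y" if "y \<in> ?S" for y
      using that by blast
    with \<open>a \<noteq> 0\<close> show ?thesis by (intro that[of a]) auto
  next
    case False
    then have "x \<notin> rel_interior ?S" using x by (simp add: rel_interior_nonempty_interior)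
    from supporting_hyperplane_rel_boundary[OF convex_convex_hull x(1) this] that show ?thesis
      by metis
  qed
  obtain w where w: "\<forall>i\<in>?I. 0 \<le> w i" "sum w ?I = 1" "(\<Sum>i\<in>?I. w i *\<^sub>R X i) = x"
    using x(1) by (auto simp: in_convex_hull_image_iff)
  have sum0: "(\<Sum>i\<in>?I. w i *\<^sub>R (X i - x)) = 0"
    using w by (simp add: scaleR_diff_right sum_subtractf flip: scaleR_sum_left)
  have "(\<Sum>i\<in>?I. w i * (a \<bullet> (X i - x))) = a \<bullet> (\<Sum>i\<in>?I. w i *\<^sub>R (X i - x))"
    by (simp add: inner_sum_right)
  then have "(\<Sum>i\<in>?I. w i * (a \<bullet> (X i - x))) = 0"
    by (simp only: sum0 inner_zero_right)
  moreover have "0 \<le> w i * (a \<bullet> (X i - x))" if "i \<in> ?I" for i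
    using w(1) a(2)[of "X i"] that by (auto simp: inner_diff_right hull_inc)
  ultimately have orth: "w i = 0 \<or> a \<bullet> (X i - x) = 0" if "i \<in> ?I" for i
    using that by (subst (asm) sum_nonneg_eq_0_iff) auto
  show False
  proof (cases "\<exists>i\<in>?I. w i = 0")
    case True
    then obtain i where i: "i \<in> ?I" "w i = 0" by blast
    then have "(\<Sum>j\<in>?I - {i}. w j *\<^sub>R (X j - x)) = 0"
      using sum0 by (simp add: sum_diff1)
    with indep[OF i(1)] have "\<forall>j\<in>?I - {i}. w j = 0"
      unfolding independent_family_def by blast
    then have "sum w ?I = 0" using i(2) by (intro sum.neutral) auto
    with w show False by simp
  next
    case False
    then have "\<And>j. j \<in> ?I \<Longrightarrow> (X j - x) \<bullet> a = 0"
      using orth by (auto simp: inner_commute)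
    with independent_family_orthogonal[OF indep[of 0], of a] have "a = 0" by auto
    with a(1) show False by simp
  qed
qed

section \<open>Continuity, semicontinuity and the limit at infinity\<close>

lemma measurable_indicator_simplex:
  fixes Q :: "(real^'n) measure"
  assumes "sets Q = sets borel"
  shows "(\<lambda>X. indicator (convex hull (X ` {..CARD('n)})) x :: real) \<in> borel_measurable (iid_sample Q)"
  using measurable_in_convex_hull_sample[OF assms, of "{..CARD('n)}" x] by simp

lemma continuous_simplicial_depth:
  fixes Q :: "(real^'n) measure"
  assumes Q: "prob_space Q" "sets Q = sets borel" "smooth_distribution Q"
  shows "continuous_on UNIV (simplicial_depth Q)"
proof -
  interpret PI: prob_space "iid_sample Q" by (intro prob_space_PiM Q)
  have "isCont (simplicial_depth Q) x" for x
    unfolding continuous_at_sequentially o_def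
  proof safe
    fix y :: "nat \<Rightarrow> real^'n" assume y: "y \<longlonglongrightarrow> x"
    show "(\<lambda>n. simplicial_depth Q (y n)) \<longlonglongrightarrow> simplicial_depth Q x"
      unfolding simplicial_depth_def
    proof (rule integral_dominated_convergence[where w = "\<lambda>_. 1"])
      show "AE X in iid_sample Q. (\<lambda>n. indicator (convex hull (X ` {..CARD('n)})) (y n))
           \<longlonglongrightarrow> (indicator (convex hull (X ` {..CARD('n)})) x :: real)"
        using AE_sample_independent[OF Q, of "\<lambda>_. 1" x, simplified]
      proof eventually_elim
        case (elim X)
        have "isCont (indicator (convex hull (X ` {..CARD('n)})) :: _ \<Rightarrow> real) x"
          using not_in_frontier_simplex[of X x] elim by (simp add: isCont_indicator)
        with y show ?case
          by (simp add: continuous_at_sequentially o_def)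
      qed
    qed (auto intro!: measurable_indicator_simplex Q)
  qed
  then show ?thesis by (simp add: continuous_on_eq_continuous_at)
qed

text \<open>The depth at all points within distance \<open>\<delta>\<close> of \<open>x\<close> is bounded by the probability that
  the simplex meets every half-space that contains the ball of radius \<open>\<delta>\<close> around \<open>x\<close>. As
  \<open>\<delta>\<close> tends to \<open>0\<close> these events decrease to the event that the simplex covers \<open>x\<close>.\<close>

lemma upper_semicontinuous_simplicial_depth:
  fixes Q :: "(real^'n) measure"
  assumes Q: "prob_space Q" and sQ[measurable_cong]: "sets Q = sets borel"
  shows "upper_semicontinuous (simplicial_depth Q)"
  unfolding upper_semicontinuous_def
proof (intro allI impI)
  fix x and c assume less: "simplicial_depth Q x < c"
  let ?I = "{..CARD('n)}"
  interpret PI: prob_space "iid_sample Q" by (intro prob_space_PiM Q)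
  obtain D :: "(real^'n) set" where D[measurable]: "countable D" and
     D': "\<And>U. open U \<Longrightarrow> U \<noteq> {} \<Longrightarrow> \<exists>a\<in>D. a \<in> U"
    by (rule countable_dense_directions) blast
  (* For \<delta> = 0 this is membership of x in the simplex; the slack \<delta> * norm a bounds
     the change of the left side when x is moved by at most \<delta>. *)
  define E where "E \<delta> X \<longleftrightarrow> (\<forall>a\<in>D. \<exists>i\<in>?I. a \<bullet> x \<le> a \<bullet> X i + \<delta> * norm a)" for \<delta> :: real and X
  have mE[measurable]: "Measurable.pred (iid_sample Q) (E \<delta>)" for \<delta>
    unfolding E_def by measurable
  let ?d = "\<lambda>n::nat. 1 / (real n + 1)"
  have lim: "(\<lambda>n. \<integral>X. of_bool (E (?d n) X) \<partial>iid_sample Q) \<longlonglongrightarrow> simplicial_depth Q x"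
    unfolding simplicial_depth_def
  proof (rule integral_dominated_convergence[where w = "\<lambda>_. 1"])
    show "AE X in iid_sample Q. (\<lambda>n. of_bool (E (?d n) X)) \<longlonglongrightarrow> (indicator (convex hull (X ` ?I)) x :: real)"
    proof (rule AE_I2)
      fix X
      show "(\<lambda>n. of_bool (E (?d n) X)) \<longlonglongrightarrow> (indicator (convex hull (X ` ?I)) x :: real)"
      proof (cases "x \<in> convex hull (X ` ?I)")
        case True
        then have "E (?d n) X" for n
          unfolding E_def using in_convex_hull_iff_countable_halfspaces[of ?I D x X, OF _ D']
          by (force intro: add_increasing2)
        with True show ?thesis by simp
      next
        case False
        then obtain a where a: "\<forall>i\<in>?I. a \<bullet> X i < a \<bullet> x" "a \<in> D"
          using in_convex_hull_iff_countable_halfspaces[of ?I D x X, OF _ D'] by (force simp: not_le)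
        have "\<forall>\<^sub>F n in sequentially. \<forall>i\<in>?I. a \<bullet> X i + ?d n * norm a < a \<bullet> x"
        proof (rule eventually_ball_finite, simp, rule ballI)
          fix i assume "i \<in> ?I"
          have "(\<lambda>n. a \<bullet> X i + ?d n * norm a) \<longlonglongrightarrow> a \<bullet> X i + 0 * norm a"
            using LIMSEQ_inverse_real_of_nat
            by (intro tendsto_intros) (simp add: inverse_eq_divide add.commute)
          from order_tendstoD(2)[OF this, of "a \<bullet> x"] a \<open>i \<in> ?I\<close>
          show "\<forall>\<^sub>F n in sequentially. a \<bullet> X i + ?d n * norm a < a \<bullet> x" by auto
        qed
        then have "\<forall>\<^sub>F n in sequentially. \<not> E (?d n) X"
          by eventually_elim (use a in \<open>auto simp: E_def not_le\<close>)
        then have "\<forall>\<^sub>F n in sequentially. of_bool (E (?d n) X) = (indicator (convex hull (X ` ?I)) x :: real)"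
          by eventually_elim (use False in auto)
        then show ?thesis by (rule tendsto_eventually)
      qed
    qed
  qed (auto intro!: measurable_indicator_simplex sQ)
  from order_tendstoD(2)[OF this less] obtain n where n: "(\<integral>X. of_bool (E (?d n) X) \<partial>iid_sample Q) < c"
    by (auto dest: eventually_happens)
  have "simplicial_depth Q y < c" if y: "dist y x < ?d n" for y
  proof -
    have "simplicial_depth Q y \<le> (\<integral>X. of_bool (E (?d n) X) \<partial>iid_sample Q)"
      unfolding simplicial_depth_def
    proof (rule integral_mono)
      fix X
      show "indicator (convex hull (X ` ?I)) y \<le> (of_bool (E (?d n) X) :: real)"
      proof (cases "y \<in> convex hull (X ` ?I)")
        case True
        have "E (?d n) X"
          unfolding E_def
        proof
          fix a assume "a \<in> D"
          then obtain i where i: "i \<in> ?I" "a \<bullet> y \<le> a \<bullet> X i"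
            using True in_convex_hull_iff_countable_halfspaces[of ?I D y X, OF _ D'] by auto
          have "a \<bullet> (x - y) \<le> norm a * norm (x - y)" by (rule norm_cauchy_schwarz)
          also have "\<dots> \<le> norm a * ?d n"
            using y by (intro mult_left_mono) (auto simp: dist_norm norm_minus_commute)
          finally show "\<exists>i\<in>?I. a \<bullet> x \<le> a \<bullet> X i + ?d n * norm a"
            using i by (intro bexI[of _ i]) (auto simp: inner_diff_right mult.commute)
        qed
        then show ?thesis by (simp add: indicator_def)
      qed simp
    qed (auto intro!: PI.integrable_const_bound[where B=1] measurable_indicator_simplex sQ)
    with n show ?thesis by linarith
  qed
  then show "\<forall>\<^sub>F y in nhds x. simplicial_depth Q y < c"
    unfolding eventually_nhds_metric by (intro exI[of _ "?d n"]) simp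
qed

lemma simplicial_depth_at_infinity:
  fixes Q :: "(real^'n) measure"
  assumes Q: "prob_space Q" and sQ[measurable_cong]: "sets Q = sets borel"
  shows "(simplicial_depth Q \<longlongrightarrow> 0) at_infinity"
proof -
  let ?I = "{..CARD('n)}"
  interpret PI: prob_space "iid_sample Q" by (intro prob_space_PiM Q)
  let ?h = "\<lambda>r. \<integral>X. (of_bool (\<exists>i\<in>?I. r \<le> norm (X i)) :: real) \<partial>iid_sample Q"
  have "(?h \<longlongrightarrow> (\<integral>X. 0 \<partial>iid_sample Q)) at_top"
  proof (rule integral_dominated_convergence_at_top[where w = "\<lambda>_. 1"])
    show "AE X in iid_sample Q. ((\<lambda>r. of_bool (\<exists>i\<in>?I. r \<le> norm (X i)) :: real) \<longlongrightarrow> 0) at_top"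
    proof (rule AE_I2)
      fix X :: "nat \<Rightarrow> real^'n"
      have "\<forall>\<^sub>F r in at_top. \<forall>i\<in>?I. norm (X i) < r"
        by (rule eventually_ball_finite) (auto intro: eventually_gt_at_top)
      then have "\<forall>\<^sub>F r in at_top. (of_bool (\<exists>i\<in>?I. r \<le> norm (X i)) :: real) = 0"
        by eventually_elim (auto simp: not_le)
      then show "((\<lambda>r. of_bool (\<exists>i\<in>?I. r \<le> norm (X i)) :: real) \<longlongrightarrow> 0) at_top"
        by (rule tendsto_eventually)
    qed
  qed (auto)
  then have "((\<lambda>x :: real^'n. ?h (norm x)) \<longlongrightarrow> 0) at_infinity"
    by (intro filterlim_compose[OF _ filterlim_norm_at_top]) simp
  moreover have "simplicial_depth Q x \<le> ?h (norm x)" for x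
    unfolding simplicial_depth_def
  proof (rule integral_mono)
    fix X
    show "indicator (convex hull (X ` ?I)) x \<le> (of_bool (\<exists>i\<in>?I. norm x \<le> norm (X i)) :: real)"
    proof (cases "\<exists>i\<in>?I. norm x \<le> norm (X i)")
      case False
      then have "convex hull (X ` ?I) \<subseteq> ball 0 (norm x)"
        by (intro hull_minimal convex_ball) (auto simp: not_le)
      then have "x \<notin> convex hull (X ` ?I)" by auto
      then show ?thesis by simp
    qed (simp add: indicator_def)
  qed (auto intro!: PI.integrable_const_bound[where B=1] measurable_indicator_simplex sQ)
  moreover have "0 \<le> simplicial_depth Q x" for x
    unfolding simplicial_depth_def by (rule Bochner_Integration.integral_nonneg) auto
  ultimately show ?thesis
    using tendsto_sandwich[of "\<lambda>_. 0" "simplicial_depth Q" at_infinity "\<lambda>x. ?h (norm x)" 0]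
    by simp
qed

section \<open>Counting the sign patterns whose simplex covers a point\<close>

definition flip_sign :: "nat set \<Rightarrow> nat \<Rightarrow> real" where
  "flip_sign T j = (if j \<in> T then - 1 else 1)"

text \<open>The index set has one element more than the dimension of the span of the vectors: \<open>c\<close> is their
  only linear relation, up to a factor, because omitting \<open>i0\<close> leaves independent vectors. The
  last assumption keeps \<open>x\<close> off the affine hull of each facet of each simplex whose vertices are
  the \<open>X\<^sub>j\<close> up to signs.\<close>

locale signed_simplices =
  fixes I :: "nat set" and X :: "nat \<Rightarrow> 'a::real_vector" and x :: 'a and c :: "nat \<Rightarrow> real" and i0 :: nat
  assumes fin: "finite I"
    and base: "i0 \<in> I" and indep: "independent_family (I - {i0}) X"
    and c: "\<exists>i\<in>I. c i \<noteq> 0" "(\<Sum>i\<in>I. c i *\<^sub>R X i) = 0"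
    and gen: "\<And>T i. i \<in> I \<Longrightarrow> independent_family (I - {i}) (\<lambda>j. flip_sign T j *\<^sub>R X j - x)"
begin

text \<open>The absolute values of such coefficients are barycentric coordinates of \<open>x\<close> in the simplex of
  their sign pattern, and a vanishing one would put \<open>x\<close> on a facet.\<close>

lemma coord_neq_0:
  assumes "(\<Sum>i\<in>I. z i *\<^sub>R X i) = x" "(\<Sum>i\<in>I. \<bar>z i\<bar>) = 1" "i \<in> I"
  shows "z i \<noteq> 0"
proof
  assume 0: "z i = 0"
  (* With this sign pattern, z j = \<bar>z j\<bar> * flip_sign ?T j. *)
  let ?T = "{j. z j < 0}"
  have "(\<Sum>j\<in>I - {i}. \<bar>z j\<bar> *\<^sub>R (flip_sign ?T j *\<^sub>R X j - x)) = (\<Sum>j\<in>I. \<bar>z j\<bar> *\<^sub>R (flip_sign ?T j *\<^sub>R X j - x))"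
    using 0 fin by (intro sum.mono_neutral_left) auto
  also have "\<dots> = (\<Sum>j\<in>I. z j *\<^sub>R X j - \<bar>z j\<bar> *\<^sub>R x)"
    by (intro sum.cong) (auto simp: flip_sign_def scaleR_diff_right)
  also have "\<dots> = 0"
    using assms by (simp add: sum_subtractf flip: scaleR_sum_left)
  finally have "\<forall>j\<in>I - {i}. \<bar>z j\<bar> = 0"
    using gen[OF \<open>i \<in> I\<close>, of ?T, unfolded independent_family_def,
        THEN spec, of "\<lambda>j. \<bar>z j\<bar>"] by simp
  then have "(\<Sum>j\<in>I. \<bar>z j\<bar>) = 0"
    using 0 by (intro sum.neutral) auto
  with assms show False by simp
qed

lemma c_base_neq_0: "c i0 \<noteq> 0"
proof
  assume "c i0 = 0"
  then have "(\<Sum>i\<in>I - {i0}. c i *\<^sub>R X i) = 0"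
    using c(2) fin base by (simp add: sum_diff1)
  then have "\<forall>i\<in>I - {i0}. c i = 0"
    using indep unfolding independent_family_def by blast
  then show False using c(1) \<open>c i0 = 0\<close> by auto
qed

lemma representation_unique:
  assumes "(\<Sum>i\<in>I. z i *\<^sub>R X i) = x" "(\<Sum>i\<in>I. z' i *\<^sub>R X i) = x"
  obtains k where "\<And>i. i \<in> I \<Longrightarrow> z' i = z i + k * c i"
proof -
  define k where "k = (z' i0 - z i0) / c i0"
  define d where "d i = z' i - z i - k * c i" for i
  have "d i0 = 0" using c_base_neq_0 by (simp add: d_def k_def)
  have "(\<Sum>i\<in>I. d i *\<^sub>R X i) = (\<Sum>i\<in>I. z' i *\<^sub>R X i) - (\<Sum>i\<in>I. z i *\<^sub>R X i) - k *\<^sub>R (\<Sum>i\<in>I. c i *\<^sub>R X i)"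
    by (simp add: d_def scaleR_diff_left sum_subtractf scaleR_sum_right)
  then have "(\<Sum>i\<in>I - {i0}. d i *\<^sub>R X i) = 0"
    using assms c(2) fin base \<open>d i0 = 0\<close> by (simp add: sum_diff1)
  then have "\<forall>i\<in>I - {i0}. d i = 0"
    using indep unfolding independent_family_def by blast
  then have "\<And>i. i \<in> I \<Longrightarrow> d i = 0" using \<open>d i0 = 0\<close> by auto
  then show ?thesis
    by (intro that[of k]) (force simp: d_def)
qed

text \<open>A representation of \<open>x\<close> with mass at most \<open>1\<close> is fixed, and \<open>k\<close> parametrises the line of all
  representations.\<close>

context
  fixes z :: "nat \<Rightarrow> real"
  assumes z: "(\<Sum>i\<in>I. z i *\<^sub>R X i) = x" "(\<Sum>i\<in>I. \<bar>z i\<bar>) \<le> 1"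
begin

definition mass where "mass k = (\<Sum>i\<in>I. \<bar>z i + k * c i\<bar>)"

text \<open>At a point where no coefficient vanishes this is the derivative of \<open>mass\<close>, and everywhere it is
  a subgradient.\<close>

definition slope where "slope k = (\<Sum>i\<in>I. sgn (z i + k * c i) * c i)"

lemma line: "(\<Sum>i\<in>I. (z i + k * c i) *\<^sub>R X i) = x"
proof -
  have "(\<Sum>i\<in>I. (z i + k * c i) *\<^sub>R X i) = (\<Sum>i\<in>I. z i *\<^sub>R X i) + k *\<^sub>R (\<Sum>i\<in>I. c i *\<^sub>R X i)"
    by (simp add: scaleR_add_left sum.distrib scaleR_sum_right)
  then show ?thesis using z c by simp
qed

lemma line_neq_0: "mass k = 1 \<Longrightarrow> i \<in> I \<Longrightarrow> z i + k * c i \<noteq> 0"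
  using coord_neq_0[OF line] by (simp add: mass_def)

text \<open>With slope zero one could move along the line, keeping the mass equal to \<open>1\<close>, until the first
  coefficient vanishes; \<open>coord_neq_0\<close> excludes this.\<close>

lemma slope_neq_0:
  assumes "mass k = 1" shows "slope k \<noteq> 0"
proof
  assume slope: "slope k = 0"
  let ?y = "\<lambda>i. z i + k * c i"
  let ?J = "{i\<in>I. c i \<noteq> 0}"
  (* i is the index whose coefficient vanishes first, and h the signed distance to that point:
     no other coefficient changes sign before. *)
  define i where "i = arg_min_on (\<lambda>i. \<bar>?y i / c i\<bar>) ?J"
  have "finite ?J" "?J \<noteq> {}" using fin c by auto
  then have i: "i \<in> ?J" and min: "\<And>j. j \<in> ?J \<Longrightarrow> \<bar>?y i / c i\<bar> \<le> \<bar>?y j / c j\<bar>"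
    unfolding i_def by (auto intro: arg_min_least dest: arg_min_if_finite[of _ "\<lambda>i. \<bar>?y i / c i\<bar>"])
  define h where "h = - ?y i / c i"
  have le: "\<bar>h * c j\<bar> \<le> \<bar>?y j\<bar>" if "j \<in> I" for j
  proof (cases "c j = 0")
    case False
    then have "\<bar>h\<bar> \<le> \<bar>?y j / c j\<bar>"
      using min[of j] that unfolding h_def by (simp only: minus_divide_left[symmetric] abs_minus_cancel) simp
    then show ?thesis using False by (simp add: abs_mult field_simps)
  qed simp
  have "mass (k + h) = (\<Sum>j\<in>I. \<bar>?y j\<bar> + h * (sgn (?y j) * c j))"
    unfolding mass_def
  proof (rule sum.cong[OF refl])
    fix j assume "j \<in> I"
    from le[OF this] show "\<bar>z j + (k + h) * c j\<bar> = \<bar>?y j\<bar> + h * (sgn (?y j) * c j)"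
      by (cases "?y j" "0::real" rule: linorder_cases) (auto simp: algebra_simps)
  qed
  also have "\<dots> = mass k + h * slope k"
    by (simp add: mass_def slope_def sum.distrib sum_distrib_left)
  finally have "mass (k + h) = 1" using slope assms by simp
  then have "z i + (k + h) * c i \<noteq> 0" using i by (intro line_neq_0) auto
  moreover have "z i + (k + h) * c i = 0" using i by (simp add: h_def field_simps)
  ultimately show False by simp
qed

lemma subgradient: "mass k + slope k * (k' - k) \<le> mass k'"
proof -
  have "\<bar>z i + k * c i\<bar> + sgn (z i + k * c i) * c i * (k' - k) \<le> \<bar>z i + k' * c i\<bar>" for i
    by (cases "z i + k * c i" "0::real" rule: linorder_cases) (auto simp: algebra_simps)
  then show ?thesis
    unfolding mass_def slope_def sum_distrib_right sum.distrib[symmetric] by (intro sum_mono)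
qed

text \<open>Convexity forces the mass to cross level \<open>1\<close> downwards first and upwards afterwards, so there
  is no room for a third crossing.\<close>

lemma slope_signs:
  assumes "mass k = 1" "mass k' = 1" "k < k'"
  shows "slope k < 0" "slope k' > 0"
  using subgradient[of k k'] subgradient[of k' k] assms slope_neq_0[of k] slope_neq_0[of k']
  by (auto simp: mult_le_0_iff)

text \<open>A representation of mass exactly \<open>1\<close> can be improved by a small step against the slope.\<close>

lemma below_1: "\<exists>k. mass k < 1"
proof (cases "mass 0 = 1")
  case False
  then show ?thesis using z(2) by (intro exI[of _ 0]) (simp add: mass_def)
next
  case True
  have "\<forall>\<^sub>F k in nhds 0. \<forall>i\<in>I. 0 < (z i + k * c i) * z i"
  proof (rule eventually_ball_finite[OF fin], rule ballI)
    fix i assume "i \<in> I"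
    then have "z i \<noteq> 0" using line_neq_0[OF True] by simp
    have "((\<lambda>k. (z i + k * c i) * z i) \<longlongrightarrow> (z i + 0 * c i) * z i) (nhds 0)"
      by (intro tendsto_intros filterlim_ident)
    from order_tendstoD(1)[OF this, of 0] show "\<forall>\<^sub>F k in nhds 0. 0 < (z i + k * c i) * z i"
      using \<open>z i \<noteq> 0\<close> by (simp flip: power2_eq_square)
  qed
  then obtain d where d: "d > 0" "\<And>k. \<bar>k\<bar> < d \<Longrightarrow> \<forall>i\<in>I. 0 < (z i + k * c i) * z i"
    unfolding eventually_nhds_metric by (auto simp: dist_real_def)
  (* Up to distance d no coefficient changes sign, so the slope is constant there. *)
  define k where "k = - sgn (slope 0) * (d / 2)"
  have "slope 0 \<noteq> 0" by (rule slope_neq_0[OF True])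
  then have "\<bar>k\<bar> < d" using d(1) by (simp add: k_def abs_mult)
  from d(2)[OF this] have "slope k = slope 0"
    unfolding slope_def by (intro sum.cong) (auto simp: zero_less_mult_iff)
  with subgradient[of k 0] have "mass k \<le> 1 + k * slope 0" using True by (simp add: algebra_simps)
  moreover have "k * slope 0 < 0"
    using \<open>slope 0 \<noteq> 0\<close> d(1) by (auto simp: k_def sgn_if mult_less_0_iff)
  ultimately show ?thesis by (intro exI[of _ k]) linarith
qed

lemma two_crossings:
  obtains k1 k2 where "k1 < k2" "{k. mass k = 1} = {k1, k2}"
proof -
  obtain k0 where k0: "mass k0 < 1" using below_1 by blast
  obtain j where j: "j \<in> I" "c j \<noteq> 0" using c by blast
  have mass_ge: "\<bar>z j + k * c j\<bar> \<le> mass k" for k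
    unfolding mass_def by (rule member_le_sum[OF j(1), of "\<lambda>i. \<bar>z i + k * c i\<bar>"]) (use fin in auto)
  have cont: "continuous_on A mass" for A
    unfolding mass_def by (intro continuous_intros)
  (* A step of length R changes the j-th coefficient by 2, from less than 1 to more than 1 in
     absolute value. *)
  define R where "R = 2 / \<bar>c j\<bar>"
  have R: "R > 0" "R * \<bar>c j\<bar> = 2" using j by (auto simp: R_def)
  have ge: "1 \<le> mass (k0 + s)" if "\<bar>s\<bar> = R" for s
  proof -
    have "\<bar>s * c j\<bar> = 2" using R that by (simp add: abs_mult)
    moreover have "\<bar>z j + k0 * c j\<bar> < 1" using mass_ge[of k0] k0 by simp
    ultimately have "1 \<le> \<bar>z j + (k0 + s) * c j\<bar>" by (simp add: algebra_simps)
    then show ?thesis using mass_ge[of "k0 + s"] by simp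
  qed
  have "\<exists>k\<ge>k0. k \<le> k0 + R \<and> mass k = 1"
    using ge[of R] R k0 by (intro IVT' cont) auto
  then obtain k2 where k2: "k0 \<le> k2" "mass k2 = 1" by blast
  have "\<exists>k\<ge>k0 - R. k \<le> k0 \<and> mass k = 1"
    using ge[of "- R"] R k0 by (intro IVT2' cont) auto
  then obtain k1 where k1: "k1 \<le> k0" "mass k1 = 1" by blast
  have "k1 < k2" using k0 k1 k2 by (metis less_irrefl order_antisym not_le order_trans)
  moreover have "k = k1 \<or> k = k2" if "mass k = 1" for k
  proof (rule ccontr)
    assume "\<not> ?thesis"
    then have "k < k1 \<or> (k1 < k \<and> k < k2) \<or> k2 < k" by auto
    then show False
      using slope_signs[of k k1] slope_signs[of k1 k] slope_signs[of k k2] slope_signs[of k2 k]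
         slope_signs[of k1 k2] that k1 k2 \<open>k1 < k2\<close> by auto
  qed
  ultimately show ?thesis using k1 k2 by (intro that[of k1 k2]) auto
qed

text \<open>Each crossing of level \<open>1\<close> yields the sign pattern of its coefficients. Patterns determine
  crossings because two crossings with the same pattern would have the same slope, and crossings
  determine patterns because no coefficient vanishes.\<close>

lemma card_signs_eq_2: "card {T. T \<subseteq> I \<and> x \<in> convex hull ((\<lambda>j. flip_sign T j *\<^sub>R X j) ` I)} = 2"
  (is "card ?\<T> = 2")
proof -
  let ?neg = "\<lambda>k. {i\<in>I. z i + k * c i < 0}"
  have "bij_betw ?neg {k. mass k = 1} ?\<T>"
    unfolding bij_betw_def
  proof (intro conjI inj_onI)
    have *: False if "mass k = 1" "mass k' = 1" "?neg k = ?neg k'" "k < k'" for k k'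
    proof -
      have "slope k = slope k'" unfolding slope_def
      proof (rule sum.cong[OF refl])
        fix i assume i: "i \<in> I"
        then have "z i + k * c i < 0 \<longleftrightarrow> z i + k' * c i < 0" using that(3) by blast
        then show "sgn (z i + k * c i) * c i = sgn (z i + k' * c i) * c i"
          using line_neq_0[OF that(1) i] line_neq_0[OF that(2) i] by (auto simp: sgn_if)
      qed
      then show False using slope_signs[of k k'] that by simp
    qed
    show "k = k'" if "k \<in> {k. mass k = 1}" "k' \<in> {k. mass k = 1}" "?neg k = ?neg k'" for k k'
      using *[of k k'] *[of k' k] that by (cases k k' rule: linorder_cases) auto
    show "?neg ` {k. mass k = 1} = ?\<T>"
    proof (intro equalityI subsetI)
      fix T assume "T \<in> ?neg ` {k. mass k = 1}"
      then obtain k where k: "mass k = 1" "T = ?neg k" by auto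
      have "(\<Sum>i\<in>I. \<bar>z i + k * c i\<bar> *\<^sub>R (flip_sign T i *\<^sub>R X i)) = (\<Sum>i\<in>I. (z i + k * c i) *\<^sub>R X i)"
        by (intro sum.cong) (auto simp: flip_sign_def k(2))
      then have "x \<in> convex hull ((\<lambda>j. flip_sign T j *\<^sub>R X j) ` I)"
        unfolding in_convex_hull_image_iff[OF fin] line
        using k(1) by (intro exI[of _ "\<lambda>i. \<bar>z i + k * c i\<bar>"]) (simp add: mass_def)
      then show "T \<in> ?\<T>" using k by auto
    next
      fix T assume T: "T \<in> ?\<T>"
      then obtain w where w: "\<forall>i\<in>I. 0 \<le> w i" "sum w I = 1"
          "(\<Sum>i\<in>I. w i *\<^sub>R (flip_sign T i *\<^sub>R X i)) = x"
        by (auto simp: in_convex_hull_image_iff[OF fin])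
      then have "(\<Sum>i\<in>I. (w i * flip_sign T i) *\<^sub>R X i) = x" by simp
      then obtain k where k: "\<And>i. i \<in> I \<Longrightarrow> w i * flip_sign T i = z i + k * c i"
        using representation_unique[OF z(1), of "\<lambda>i. w i * flip_sign T i"] by metis
      have "mass k = (\<Sum>i\<in>I. w i)"
        unfolding mass_def by (intro sum.cong) (use w in \<open>auto simp flip: k simp: abs_mult flip_sign_def\<close>)
      then have mass: "mass k = 1" using w by simp
      have "i \<in> T \<longleftrightarrow> z i + k * c i < 0" if i: "i \<in> I" for i
        using line_neq_0[OF mass i] w(1) i unfolding k[OF i, symmetric]
        by (auto simp: flip_sign_def less_le)
      then have "T = ?neg k" using T by auto
      with mass show "T \<in> ?neg ` {k. mass k = 1}" by blast
    qed
  qed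
  then have "card ?\<T> = card {k. mass k = 1}"
    by (simp add: bij_betw_same_card)
  also obtain k1 k2 where "k1 < k2" "{k. mass k = 1} = {k1, k2}" by (rule two_crossings)
  then have "card {k. mass k = 1} = 2" by simp
  finally show ?thesis .
qed

end

lemma card_signs:
  "card {T. T \<subseteq> I \<and> x \<in> convex hull ((\<lambda>j. flip_sign T j *\<^sub>R X j) ` I)}
     = (if \<exists>z. (\<Sum>i\<in>I. z i *\<^sub>R X i) = x \<and> (\<Sum>i\<in>I. \<bar>z i\<bar>) \<le> 1 then 2 else 0)"
proof (cases "\<exists>z. (\<Sum>i\<in>I. z i *\<^sub>R X i) = x \<and> (\<Sum>i\<in>I. \<bar>z i\<bar>) \<le> 1")
  case True
  then show ?thesis using card_signs_eq_2 by auto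
next
  case False
  have "x \<notin> convex hull ((\<lambda>j. flip_sign T j *\<^sub>R X j) ` I)" for T
  proof
    assume "x \<in> convex hull ((\<lambda>j. flip_sign T j *\<^sub>R X j) ` I)"
    then obtain w where w: "\<forall>i\<in>I. 0 \<le> w i" "sum w I = 1"
        "(\<Sum>i\<in>I. w i *\<^sub>R (flip_sign T i *\<^sub>R X i)) = x"
      by (auto simp: in_convex_hull_image_iff[OF fin])
    have "(\<Sum>i\<in>I. \<bar>w i * flip_sign T i\<bar>) = sum w I"
      by (intro sum.cong) (use w in \<open>auto simp: abs_mult flip_sign_def\<close>)
    then show False
      using False w by (auto dest!: spec[of _ "\<lambda>i. w i * flip_sign T i"])
  qed
  with False show ?thesis by simp
qed

end

section \<open>Simplicial depth of a centrally symmetric distribution\<close>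

text \<open>The maps may differ from coordinate to coordinate, as is needed for flipping the signs of only
  some of the vertices.\<close>

lemma distr_PiM_measure_preserving:
  assumes Q: "prob_space Q" and I: "finite I"
    and f[measurable]: "\<And>i. f i \<in> Q \<rightarrow>\<^sub>M Q" and pres: "\<And>i. distr Q Q (f i) = Q"
  shows "distr (Pi\<^sub>M I (\<lambda>_. Q)) (Pi\<^sub>M I (\<lambda>_. Q)) (\<lambda>X. \<lambda>i\<in>I. f i (X i)) = Pi\<^sub>M I (\<lambda>_. Q)"
proof -
  interpret Q: prob_space Q by fact
  interpret product_prob_space "\<lambda>_. Q" I ..
  show ?thesis
  proof (rule PiM_eqI[OF I])
    fix A assume A: "\<And>i. i \<in> I \<Longrightarrow> A i \<in> sets Q"
    have "emeasure (distr (Pi\<^sub>M I (\<lambda>_. Q)) (Pi\<^sub>M I (\<lambda>_. Q)) (\<lambda>X. \<lambda>i\<in>I. f i (X i))) (Pi\<^sub>E I A)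
        = emeasure (Pi\<^sub>M I (\<lambda>_. Q)) ((\<lambda>X. \<lambda>i\<in>I. f i (X i)) -` Pi\<^sub>E I A \<inter> space (Pi\<^sub>M I (\<lambda>_. Q)))"
      using I A by (intro emeasure_distr) (measurable, auto intro!: sets_PiM_I_finite)
    also have "(\<lambda>X. \<lambda>i\<in>I. f i (X i)) -` Pi\<^sub>E I A \<inter> space (Pi\<^sub>M I (\<lambda>_. Q))
        = Pi\<^sub>E I (\<lambda>i. f i -` A i \<inter> space Q)"
      by (auto simp: space_PiM PiE_iff)
    also have "emeasure (Pi\<^sub>M I (\<lambda>_. Q)) \<dots> = (\<Prod>i\<in>I. emeasure Q (f i -` A i \<inter> space Q))"
      using I A by (intro emeasure_PiM) auto
    also have "\<dots> = (\<Prod>i\<in>I. emeasure (distr Q Q (f i)) (A i))"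
      using A by (intro prod.cong refl emeasure_distr[symmetric]) auto
    finally show "emeasure (distr (Pi\<^sub>M I (\<lambda>_. Q)) (Pi\<^sub>M I (\<lambda>_. Q)) (\<lambda>X. \<lambda>i\<in>I. f i (X i))) (Pi\<^sub>E I A)
        = (\<Prod>i\<in>I. emeasure Q (A i))"
      by (simp only: pres)
  qed simp
qed

lemma centrally_symmetric_about_0_iff:
  assumes sQ: "sets Q = sets borel"
  shows "centrally_symmetric_about Q 0 \<longleftrightarrow> distr Q Q uminus = Q"
proof -
  have "distr Q borel (\<lambda>x. x) = Q"
    using sQ by (intro distr_id2) simp
  moreover have "distr Q Q uminus = distr Q borel uminus"
    using sQ by (intro distr_cong) simp_all
  ultimately show ?thesis
    by (auto simp: centrally_symmetric_about_def)
qed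

lemma simplicial_depth_sign_flip:
  fixes Q :: "(real^'n) measure"
  assumes Q: "prob_space Q" and sQ[measurable_cong]: "sets Q = sets borel" and sym: "centrally_symmetric_about Q 0"
  shows "(\<lambda>X. indicator (convex hull ((\<lambda>j. flip_sign T j *\<^sub>R X j) ` {..CARD('n)})) x :: real) \<in> borel_measurable (iid_sample Q)" (is ?th1)
    and "simplicial_depth Q x
      = (\<integral>X. indicator (convex hull ((\<lambda>j. flip_sign T j *\<^sub>R X j) ` {..CARD('n)})) x \<partial>iid_sample Q)" (is ?th2)
proof -
  let ?I = "{..CARD('n)}"
  let ?F = "\<lambda>X. \<lambda>j\<in>?I. flip_sign T j *\<^sub>R X j"
  have [measurable]: "?F \<in> iid_sample Q \<rightarrow>\<^sub>M iid_sample Q"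
    by measurable
  have pres: "distr (iid_sample Q) (iid_sample Q) ?F = iid_sample Q"
  proof (rule distr_PiM_measure_preserving[OF Q, of ?I "\<lambda>j w. flip_sign T j *\<^sub>R w"])
    show "distr Q Q (\<lambda>w. flip_sign T j *\<^sub>R w) = Q" for j
    proof (cases "j \<in> T")
      case True
      then have "(\<lambda>w :: real^'n. flip_sign T j *\<^sub>R w) = uminus" by (auto simp: flip_sign_def)
      then show ?thesis using sym sQ by (simp add: centrally_symmetric_about_0_iff)
    qed (auto simp: flip_sign_def distr_id2)
  qed auto
  have img: "?F X ` ?I = (\<lambda>j. flip_sign T j *\<^sub>R X j) ` ?I" for X :: "nat \<Rightarrow> real^'n"
    by (auto simp: image_def)
  note m = measurable_indicator_simplex[OF sQ, of x]
  from measurable_compose[OF \<open>?F \<in> _\<close> m] show ?th1 by (simp only: img)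
  have "simplicial_depth Q x = (\<integral>X. indicator (convex hull (X ` ?I)) x \<partial>distr (iid_sample Q) (iid_sample Q) ?F)"
    by (simp only: pres simplicial_depth_def)
  also have "\<dots> = (\<integral>X. indicator (convex hull (?F X ` ?I)) x \<partial>iid_sample Q)"
    by (rule integral_distr) (use m in measurable)
  finally show ?th2 by (simp only: img)
qed

definition sign_count :: "(nat \<Rightarrow> real^'n) \<Rightarrow> real^'n \<Rightarrow> nat" where
  "sign_count X x =
     card {T. T \<subseteq> {..CARD('n)} \<and> x \<in> convex hull ((\<lambda>j. flip_sign T j *\<^sub>R X j) ` {..CARD('n)})}"

lemma sign_count_eq_sum:
  fixes X :: "nat \<Rightarrow> real^'n"
  shows "real (sign_count X x) = (\<Sum>T\<in>Pow {..CARD('n)}.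
           indicator (convex hull ((\<lambda>j. flip_sign T j *\<^sub>R X j) ` {..CARD('n)})) x)"
proof -
  let ?S = "{T. T \<subseteq> {..CARD('n)} \<and> x \<in> convex hull ((\<lambda>j. flip_sign T j *\<^sub>R X j) ` {..CARD('n)})}"
  have "real (sign_count X x) = (\<Sum>T\<in>?S. 1)"
    by (simp add: sign_count_def)
  also have "\<dots> = (\<Sum>T\<in>Pow {..CARD('n)}. indicator (convex hull ((\<lambda>j. flip_sign T j *\<^sub>R X j) ` {..CARD('n)})) x)"
    by (rule sum.mono_neutral_cong_left) (auto simp: indicator_def)
  finally show ?thesis .
qed

text \<open>Symmetry gives every one of the \<open>2\<^bsup>p+1\<^esup>\<close> sign patterns the same probability of covering
  \<open>x\<close>, so the depth is the average over all of them.\<close>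

lemma simplicial_depth_eq_sign_count:
  fixes Q :: "(real^'n) measure"
  assumes Q: "prob_space Q" "sets Q = sets borel" "centrally_symmetric_about Q 0"
  shows "integrable (iid_sample Q) (\<lambda>X. real (sign_count X x))"
    and "simplicial_depth Q x = (\<integral>X. real (sign_count X x) \<partial>iid_sample Q) / 2 ^ (CARD('n) + 1)"
proof -
  interpret PI: prob_space "iid_sample Q" by (intro prob_space_PiM Q)
  note flip = simplicial_depth_sign_flip[OF Q]
  have int: "integrable (iid_sample Q)
      (\<lambda>X. indicator (convex hull ((\<lambda>j. flip_sign T j *\<^sub>R X j) ` {..CARD('n)})) x :: real)" for T
    by (rule PI.integrable_const_bound[where B=1]) (auto intro: flip)
  then show "integrable (iid_sample Q) (\<lambda>X. real (sign_count X x))"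
    unfolding sign_count_eq_sum by (rule Bochner_Integration.integrable_sum)
  have "(\<integral>X. real (sign_count X x) \<partial>iid_sample Q) = (\<Sum>T\<in>Pow {..CARD('n)}. simplicial_depth Q x)"
    unfolding sign_count_eq_sum
    by (subst Bochner_Integration.integral_sum) (auto intro: int simp flip: flip(2))
  also have "\<dots> = 2 ^ (CARD('n) + 1) * simplicial_depth Q x"
    by (simp add: card_Pow)
  finally show "simplicial_depth Q x = (\<integral>X. real (sign_count X x) \<partial>iid_sample Q) / 2 ^ (CARD('n) + 1)"
    by simp
qed

text \<open>The relation between the \<open>p + 1\<close> vectors comes from expanding \<open>X 0\<close> in terms of the
  other vectors, which almost surely form a basis.\<close>

lemma AE_sign_count_eq:
  fixes Q :: "(real^'n) measure"
  assumes Q: "prob_space Q" "sets Q = sets borel" "smooth_distribution Q"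
  shows "AE X in iid_sample Q. sign_count X x =
    (if \<exists>z. (\<Sum>i\<le>CARD('n). z i *\<^sub>R X i) = x \<and> (\<Sum>i\<le>CARD('n). \<bar>z i\<bar>) \<le> 1 then 2 else 0)"
proof -
  let ?I = "{..CARD('n)}"
  have "AE X in iid_sample Q. \<forall>T\<in>Pow ?I. \<forall>i\<in>?I. independent_family (?I - {i}) (\<lambda>j. flip_sign T j *\<^sub>R X j - x)"
    by (intro AE_finite_allI AE_sample_independent Q) (auto simp: flip_sign_def)
  moreover have "AE X in iid_sample Q. \<forall>i\<in>?I. independent_family (?I - {i}) X"
    using AE_sample_independent[OF Q, of "\<lambda>_. 1" 0] by simp
  ultimately show ?thesis
  proof eventually_elim
    case (elim X)
    then have indep: "independent_family (?I - {0}) X" by simp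
    then obtain d where d: "X 0 = (\<Sum>j\<in>?I - {0}. d j *\<^sub>R X j)"
      by (rule independent_family_spans[of "?I - {0}" X "X 0"]) auto
    define c where "c j = (if j = 0 then - 1 else d j)" for j
    have "(\<Sum>j\<in>?I. c j *\<^sub>R X j) = c 0 *\<^sub>R X 0 + (\<Sum>j\<in>?I - {0}. c j *\<^sub>R X j)"
      by (rule sum.remove) auto
    also have "(\<Sum>j\<in>?I - {0}. c j *\<^sub>R X j) = X 0"
      unfolding d by (intro sum.cong) (auto simp: c_def)
    finally have rel: "(\<Sum>j\<in>?I. c j *\<^sub>R X j) = 0" by (simp add: c_def)
    (* Only the signs on the index set matter, and these are finitely many patterns. *)
    have gen: "independent_family (?I - {i}) (\<lambda>j. flip_sign T j *\<^sub>R X j - x)" if "i \<in> ?I" for T i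
    proof -
      have "independent_family (?I - {i}) (\<lambda>j. flip_sign (T \<inter> ?I) j *\<^sub>R X j - x)"
        using elim that by blast
      moreover have "independent_family (?I - {i}) (\<lambda>j. flip_sign (T \<inter> ?I) j *\<^sub>R X j - x)
          \<longleftrightarrow> independent_family (?I - {i}) (\<lambda>j. flip_sign T j *\<^sub>R X j - x)"
        by (rule independent_family_cong) (simp add: flip_sign_def)
      ultimately show ?thesis by simp
    qed
    interpret signed_simplices ?I X x c 0
      using indep rel gen by unfold_locales (auto simp: c_def intro!: bexI[of _ 0])
    show ?case
      unfolding sign_count_def by (rule card_signs)
  qed
qed

text \<open>Multiplying a representation of \<open>x\<close> by \<open>s\<close> represents \<open>s x\<close> with no larger mass, so the
  two-or-zero count can only increase on the way to the centre.\<close>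

lemma simplicial_depth_ray_antimono_0:
  fixes Q :: "(real^'n) measure"
  assumes Q: "prob_space Q" "sets Q = sets borel" "smooth_distribution Q" "centrally_symmetric_about Q 0"
    and st: "0 \<le> s" "s \<le> 1"
  shows "simplicial_depth Q x \<le> simplicial_depth Q (s *\<^sub>R x)"
proof -
  have "(\<integral>X. real (sign_count X x) \<partial>iid_sample Q) \<le> (\<integral>X. real (sign_count X (s *\<^sub>R x)) \<partial>iid_sample Q)"
  proof (rule integral_mono_AE)
    show "AE X in iid_sample Q. real (sign_count X x) \<le> real (sign_count X (s *\<^sub>R x))"
      using AE_sign_count_eq[OF Q(1-3), of x] AE_sign_count_eq[OF Q(1-3), of "s *\<^sub>R x"]
    proof eventually_elim
      case (elim X)
      have "\<exists>z. (\<Sum>i\<le>CARD('n). z i *\<^sub>R X i) = s *\<^sub>R x \<and> (\<Sum>i\<le>CARD('n). \<bar>z i\<bar>) \<le> 1"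
        if "(\<Sum>i\<le>CARD('n). z i *\<^sub>R X i) = x" "(\<Sum>i\<le>CARD('n). \<bar>z i\<bar>) \<le> 1" for z
      proof (intro exI[of _ "\<lambda>i. s * z i"] conjI)
        show "(\<Sum>i\<le>CARD('n). (s * z i) *\<^sub>R X i) = s *\<^sub>R x"
          by (simp add: that(1)[symmetric] scaleR_sum_right)
        have "(\<Sum>i\<le>CARD('n). \<bar>s * z i\<bar>) = s * (\<Sum>i\<le>CARD('n). \<bar>z i\<bar>)"
          using st by (simp add: abs_mult sum_distrib_left)
        also have "\<dots> \<le> 1"
          using st that(2) by (intro mult_le_one) (auto intro: sum_nonneg)
        finally show "(\<Sum>i\<le>CARD('n). \<bar>s * z i\<bar>) \<le> 1" .
      qed
      with elim show ?case by auto
    qed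
  qed (intro simplicial_depth_eq_sign_count Q)+
  then show ?thesis
    unfolding simplicial_depth_eq_sign_count(2)[OF Q(1,2,4)] by (simp add: divide_right_mono)
qed

section \<open>Affine maps and the \<open>\<sigma>\<close>-transformation\<close>

lemma iid_sample_distr:
  fixes P :: "(real^'n) measure" and f :: "real^'n \<Rightarrow> real^'n"
  assumes "prob_space P" "f \<in> P \<rightarrow>\<^sub>M borel"
  shows "iid_sample (distr P borel f) = distr (iid_sample P) (Pi\<^sub>M {..CARD('n)} (\<lambda>_. borel)) (compose {..CARD('n)} f)"
proof -
  interpret prob_space P by fact
  have "iid_sample (distr P borel f) = Pi\<^sub>M {..CARD('n)} (\<lambda>_. distr P (distr P borel f) f)"
    by (intro PiM_cong distr_cong) auto
  also have "\<dots> = distr (iid_sample P) (iid_sample (distr P borel f)) (compose {..CARD('n)} f)"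
    using assms by (intro distr_PiM_finite_prob_space'[symmetric]) (auto intro: prob_space_distr)
  also have "\<dots> = distr (iid_sample P) (Pi\<^sub>M {..CARD('n)} (\<lambda>_. borel)) (compose {..CARD('n)} f)"
    by (intro distr_cong sets_PiM_cong) auto
  finally show ?thesis .
qed

lemma prob_space_sigma_transformation:
  fixes P :: "(real^'n) measure"
  assumes P: "prob_space P" and [measurable_cong]: "sets P = sets borel"
  shows "prob_space (sigma_transformation \<sigma> P)"
proof -
  interpret PI: prob_space "iid_sample P" by (intro prob_space_PiM P)
  show ?thesis
    unfolding sigma_transformation_def sample_mean_def
    by (intro PI.prob_space_distr) measurable
qed

lemma sets_sigma_transformation [simp, measurable_cong]: "sets (sigma_transformation \<sigma> P) = sets borel"
  by (simp add: sigma_transformation_def)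

lemma borel_measurable_affine:
  fixes A :: "real^'n^'n"
  shows "(\<lambda>y. A *v y + b) \<in> borel_measurable borel"
  by (intro borel_measurable_continuous_onI continuous_intros matrix_vector_mult_linear_continuous_on)

lemma measurable_compose_sample:
  fixes P :: "(real^'n) measure" and f :: "real^'n \<Rightarrow> real^'n"
  assumes "f \<in> P \<rightarrow>\<^sub>M borel"
  shows "compose {..CARD('n)} f \<in> iid_sample P \<rightarrow>\<^sub>M Pi\<^sub>M {..CARD('n)} (\<lambda>_. borel)"
  using assms unfolding compose_def by measurable

lemma sigma_transformation_affine:
  fixes P :: "(real^'n) measure" and A :: "real^'n^'n"
  assumes P: "prob_space P" and sP[measurable_cong]: "sets P = sets borel"
  shows "sigma_transformation \<sigma> (distr P borel (\<lambda>y. A *v y + b))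
     = distr (sigma_transformation \<sigma> P) borel (\<lambda>y. A *v y + b)"
proof -
  let ?f = "\<lambda>y. A *v y + b"
  let ?h = "\<lambda>X :: nat \<Rightarrow> real^'n. \<sigma> *\<^sub>R (X 0 - sample_mean X) + sample_mean X"
  have f: "?f \<in> P \<rightarrow>\<^sub>M borel"
    using borel_measurable_affine sP by (simp cong: measurable_cong_sets)
  have h: "?h \<in> borel_measurable (Pi\<^sub>M {..CARD('n)} (\<lambda>_. borel))"
    unfolding sample_mean_def by measurable
  have hP: "?h \<in> borel_measurable (iid_sample P)"
    unfolding sample_mean_def by measurable
  have mean: "sample_mean (compose {..CARD('n)} ?f X) = ?f (sample_mean X)" for X :: "nat \<Rightarrow> real^'n"
  proof -
    have "sample_mean (compose {..CARD('n)} ?f X) = (\<Sum>j\<le>CARD('n). A *v X j + b) /\<^sub>R real (CARD('n) + 1)"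
      by (simp add: sample_mean_def compose_def)
    also have "\<dots> = (A *v (\<Sum>j\<le>CARD('n). X j) + real (CARD('n) + 1) *\<^sub>R b) /\<^sub>R real (CARD('n) + 1)"
      by (simp add: sum.distrib linear_sum[OF matrix_vector_mul_linear] sum_constant_scaleR
          del: sum_constant)
    also have "\<dots> = ?f (sample_mean X)"
      by (simp add: sample_mean_def scaleR_add_right matrix_vector_mult_scaleR del: of_nat_add)
    finally show ?thesis .
  qed
  have "?h (compose {..CARD('n)} ?f X) = ?f (?h X)" for X :: "nat \<Rightarrow> real^'n"
    unfolding mean
    by (simp add: compose_def matrix_vector_mult_scaleR matrix_vector_right_distrib matrix_vector_mult_diff_distrib)
  then have "?h \<circ> compose {..CARD('n)} ?f = ?f \<circ> ?h" by (simp add: fun_eq_iff)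
  moreover have "sigma_transformation \<sigma> (distr P borel ?f) = distr (iid_sample P) borel (?h \<circ> compose {..CARD('n)} ?f)"
    unfolding sigma_transformation_def iid_sample_distr[OF P f]
    using h by (intro trans[OF distr_distr[OF _ measurable_compose_sample[OF f]]] distr_cong) simp_all
  ultimately show ?thesis
    unfolding sigma_transformation_def
    by (simp only: distr_distr[OF borel_measurable_affine hP])
qed

lemma simplicial_depth_affine:
  fixes Q :: "(real^'n) measure" and A :: "real^'n^'n"
  assumes Q: "prob_space Q" and sQ[measurable_cong]: "sets Q = sets borel" and A: "invertible A"
  shows "simplicial_depth (distr Q borel (\<lambda>y. A *v y + b)) (A *v x + b) = simplicial_depth Q x"
proof -
  let ?f = "\<lambda>y. A *v y + b" and ?I = "{..CARD('n)}"
  have f: "?f \<in> Q \<rightarrow>\<^sub>M borel"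
    using borel_measurable_affine sQ by (simp cong: measurable_cong_sets)
  have "inj ((*v) A)" using A by (simp add: inj_matrix_vector_mult)
  have hull: "?f x \<in> convex hull (compose ?I ?f X ` ?I) \<longleftrightarrow> x \<in> convex hull (X ` ?I)" for X :: "nat \<Rightarrow> real^'n"
  proof -
    have "compose ?I ?f X ` ?I = (+) b ` ((*v) A ` (X ` ?I))"
      by (auto simp: compose_def image_image add.commute)
    then have "convex hull (compose ?I ?f X ` ?I) = (+) b ` ((*v) A ` (convex hull (X ` ?I)))"
      by (simp add: convex_hull_translation convex_hull_linear_image)
    moreover have "?f x \<in> (+) b ` ((*v) A ` S) \<longleftrightarrow> A *v x \<in> (*v) A ` S" for S
      by (auto simp: image_iff add.commute)
    ultimately show ?thesis
      using \<open>inj ((*v) A)\<close> by (simp only: inj_image_mem_iff)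
  qed
  have "simplicial_depth (distr Q borel ?f) (?f x)
      = (\<integral>X. indicator (convex hull (compose ?I ?f X ` ?I)) (?f x) \<partial>iid_sample Q)"
    unfolding simplicial_depth_def iid_sample_distr[OF Q f]
    by (intro integral_distr measurable_compose_sample f measurable_in_convex_hull_sample) auto
  also have "\<dots> = simplicial_depth Q x"
    unfolding simplicial_depth_def by (intro Bochner_Integration.integral_cong) (simp_all only: hull indicator_def)
  finally show ?thesis .
qed

text \<open>Given the other sample points, the transformed point is \<open>X 0\<close> scaled by a positive factor and
  shifted, so it avoids a fixed hyperplane almost surely.\<close>

lemma smooth_sigma_transformation:
  fixes P :: "(real^'n) measure"
  assumes P: "prob_space P" and sP[measurable_cong]: "sets P = sets borel" and smooth: "smooth_distribution P"
    and \<sigma>: "\<sigma> > 0"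
  shows "smooth_distribution (sigma_transformation \<sigma> P)"
  unfolding smooth_distribution_def
proof (intro allI impI)
  fix a :: "real^'n" and b assume "a \<noteq> 0"
  let ?h = "\<lambda>X :: nat \<Rightarrow> real^'n. \<sigma> *\<^sub>R (X 0 - sample_mean X) + sample_mean X"
  let ?N = "real (CARD('n) + 1)"
  have h[measurable]: "?h \<in> borel_measurable (iid_sample P)"
    unfolding sample_mean_def by measurable
  (* \<kappa> is the total coefficient of X 0 in the transformed point. *)
  define \<kappa> where "\<kappa> = \<sigma> + (1 - \<sigma>) / ?N"
  have "\<kappa> = (\<sigma> * real CARD('n) + 1) / ?N"
    by (simp add: \<kappa>_def field_simps)
  then have "\<kappa> > 0" using \<sigma> by (simp add: add_nonneg_pos)
  have "AE X in iid_sample P. a \<bullet> ?h X \<noteq> b"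
  proof (rule AE_resample_coordinate[OF P, of 0])
    show "AE X in iid_sample P. AE w in P. a \<bullet> ?h (X(0 := w)) \<noteq> b"
    proof (rule AE_I2)
      fix X :: "nat \<Rightarrow> real^'n"
      define r where "r = (1 - \<sigma>) *\<^sub>R ((\<Sum>j\<in>{..CARD('n)} - {0}. X j) /\<^sub>R ?N)"
      have "?h (X(0 := w)) = \<kappa> *\<^sub>R w + r" for w
      proof -
        have "(\<Sum>j\<le>CARD('n). (X(0 := w)) j) = w + (\<Sum>j\<in>{..CARD('n)} - {0}. X j)"
          by (subst sum.remove[of _ 0]) (auto intro!: sum.cong)
        then have "sample_mean (X(0 := w)) = w /\<^sub>R ?N + (\<Sum>j\<in>{..CARD('n)} - {0}. X j) /\<^sub>R ?N"
          by (simp add: sample_mean_def scaleR_add_right)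
        then show ?thesis
          by (simp add: r_def \<kappa>_def algebra_simps divide_inverse)
      qed
      then have "a \<bullet> ?h (X(0 := w)) = (\<kappa> *\<^sub>R a) \<bullet> w + a \<bullet> r" for w
        by (simp add: inner_add_right)
      moreover have "AE w in P. (\<kappa> *\<^sub>R a) \<bullet> w \<noteq> b - a \<bullet> r"
        using \<open>\<kappa> > 0\<close> \<open>a \<noteq> 0\<close> by (intro AE_not_in_hyperplane smooth sP) auto
      ultimately show "AE w in P. a \<bullet> ?h (X(0 := w)) \<noteq> b"
        by (simp add: eq_diff_eq)
    qed
  qed (auto)
  then have "AE y in sigma_transformation \<sigma> P. a \<bullet> y \<noteq> b"
    unfolding sigma_transformation_def by (subst AE_distr_iff) auto
  then have "{y. a \<bullet> y = b} \<in> null_sets (sigma_transformation \<sigma> P)"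
    by (subst (asm) AE_iff_null_sets[symmetric, of "{y. a \<bullet> y = b}", simplified])
       (auto intro!: borel_closed closed_hyperplane)
  then show "emeasure (sigma_transformation \<sigma> P) {y. a \<bullet> y = b} = 0" by auto
qed

lemma smooth_translation:
  fixes P :: "(real^'n) measure"
  assumes sP[measurable_cong]: "sets P = sets borel" and smooth: "smooth_distribution P"
  shows "smooth_distribution (distr P borel (\<lambda>y. y - \<mu>))"
  unfolding smooth_distribution_def
proof (intro allI impI)
  fix a :: "real^'n" and b assume "a \<noteq> 0"
  have "space P = UNIV" using sP sets_eq_imp_space_eq by force
  then have "emeasure (distr P borel (\<lambda>y. y - \<mu>)) {x. a \<bullet> x = b} = emeasure P {x. a \<bullet> x = b + a \<bullet> \<mu>}"
    by (subst emeasure_distr)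
       (auto intro!: borel_closed closed_hyperplane arg_cong[where f="emeasure P"] simp: inner_diff_right)
  with smooth \<open>a \<noteq> 0\<close> show "emeasure (distr P borel (\<lambda>y. y - \<mu>)) {x. a \<bullet> x = b} = 0"
    by (simp add: smooth_distribution_def)
qed

lemma centrally_symmetric_translation:
  fixes P :: "(real^'n) measure"
  assumes [measurable_cong]: "sets P = sets borel" and "centrally_symmetric_about P \<mu>"
  shows "centrally_symmetric_about (distr P borel (\<lambda>y. y - \<mu>)) 0"
  using assms(2) by (simp add: centrally_symmetric_about_def distr_distr o_def)

lemma centrally_symmetric_sigma_transformation:
  fixes P :: "(real^'n) measure"
  assumes P: "prob_space P" "sets P = sets borel" and sym: "centrally_symmetric_about P 0"
  shows "centrally_symmetric_about (sigma_transformation \<sigma> P) 0"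
proof -
  have minus: "(\<lambda>y. - mat 1 *v y + 0) = (uminus :: real^'n \<Rightarrow> _)"
    using matrix_vector_mult_diff_rdistrib[of 0 "mat 1 :: real^'n^'n"] by auto
  have eq: "centrally_symmetric_about R 0 \<longleftrightarrow> distr R borel uminus = R" if "sets R = sets borel" for R :: "(real^'n) measure"
  proof -
    have "distr R R uminus = distr R borel uminus" using that by (intro distr_cong) simp_all
    then show ?thesis using centrally_symmetric_about_0_iff[OF that] by simp
  qed
  show ?thesis
    using sigma_transformation_affine[OF P, of \<sigma> "- mat 1" 0] sym P(2)
    unfolding minus by (simp add: eq)
qed

theorem theorem14:
  fixes P :: "(real^'n) measure" and \<sigma> :: real
  assumes "prob_space P" and "sets P = sets borel" and "\<sigma> > 0"
  shows
    "(\<forall>(A :: real^'n^'n) b x. invertible A \<longrightarrow>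
        enlarged_simplicial_depth \<sigma> (distr P borel (\<lambda>y. A *v y + b)) (A *v x + b)
          = enlarged_simplicial_depth \<sigma> P x)
     \<and> (enlarged_simplicial_depth \<sigma> P \<longlongrightarrow> 0) at_infinity
     \<and> upper_semicontinuous (enlarged_simplicial_depth \<sigma> P)
     \<and> (smooth_distribution P \<longrightarrow> continuous_on UNIV (enlarged_simplicial_depth \<sigma> P))
     \<and> (\<forall>\<mu>. smooth_distribution P \<and> centrally_symmetric_about P \<mu> \<longrightarrow>
          enlarged_simplicial_depth \<sigma> P \<mu> = (SUP x. enlarged_simplicial_depth \<sigma> P x)
          \<and> (\<forall>u. antimono_on {0..} (\<lambda>t. enlarged_simplicial_depth \<sigma> P (\<mu> + t *\<^sub>R u))))"
proof (intro conjI allI impI)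
  let ?Q = "sigma_transformation \<sigma> P"
  let ?D = "enlarged_simplicial_depth \<sigma> P"
  note Q = prob_space_sigma_transformation[OF assms(1,2)] sets_sigma_transformation
  show affine: "enlarged_simplicial_depth \<sigma> (distr P borel (\<lambda>y. A *v y + b)) (A *v x + b) = ?D x"
    if "invertible A" for A :: "real^'n^'n" and b x
    unfolding enlarged_simplicial_depth_eq sigma_transformation_affine[OF assms(1,2)]
    by (rule simplicial_depth_affine[OF Q that])
  show "(?D \<longlongrightarrow> 0) at_infinity"
    unfolding enlarged_simplicial_depth_eq by (rule simplicial_depth_at_infinity[OF Q])
  show "upper_semicontinuous ?D"
    unfolding enlarged_simplicial_depth_eq by (rule upper_semicontinuous_simplicial_depth[OF Q])
  show "continuous_on UNIV ?D" if "smooth_distribution P"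
    unfolding enlarged_simplicial_depth_eq
    by (intro continuous_simplicial_depth Q smooth_sigma_transformation assms that)
  fix \<mu> assume \<mu>: "smooth_distribution P \<and> centrally_symmetric_about P \<mu>"
  let ?P' = "distr P borel (\<lambda>y. y - \<mu>)"
  have [measurable_cong]: "sets P = sets borel" by fact
  have P': "prob_space ?P'" "sets ?P' = sets borel"
    by (auto intro!: prob_space.prob_space_distr assms)
  have "prob_space (sigma_transformation \<sigma> ?P')"
    by (rule prob_space_sigma_transformation[OF P'])
  moreover have "smooth_distribution (sigma_transformation \<sigma> ?P')"
    using \<mu> by (intro smooth_sigma_transformation[OF P'] smooth_translation assms) simp
  moreover have "centrally_symmetric_about (sigma_transformation \<sigma> ?P') 0"
    using \<mu> by (intro centrally_symmetric_sigma_transformation[OF P'] centrally_symmetric_translation assms) simp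
  ultimately have centred: "enlarged_simplicial_depth \<sigma> ?P' y \<le> enlarged_simplicial_depth \<sigma> ?P' (s *\<^sub>R y)"
    if "0 \<le> s" "s \<le> 1" for s y
    unfolding enlarged_simplicial_depth_eq using that
    by (intro simplicial_depth_ray_antimono_0 sets_sigma_transformation)
  have "enlarged_simplicial_depth \<sigma> ?P' y = ?D (\<mu> + y)" for y
    using affine[of "mat 1" "- \<mu>" "\<mu> + y"] by (simp add: invertible_det_nz)
  with centred have shrink: "?D (\<mu> + y) \<le> ?D (\<mu> + s *\<^sub>R y)" if "0 \<le> s" "s \<le> 1" for s y
    using that by metis
  have "?D x \<le> ?D \<mu>" for x
    using shrink[of 0 "x - \<mu>"] by simp
  then show "?D \<mu> = (SUP x. ?D x)"
    by (intro cSup_eq_maximum[symmetric]) auto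
  show "antimono_on {0..} (\<lambda>t. ?D (\<mu> + t *\<^sub>R u))" for u
  proof (rule monotone_onI)
    fix s t :: real assume st: "s \<in> {0..}" "t \<in> {0..}" "s \<le> t"
    show "?D (\<mu> + t *\<^sub>R u) \<le> ?D (\<mu> + s *\<^sub>R u)"
    proof (cases "t = 0")
      case False
      then show ?thesis using shrink[of "s / t" "t *\<^sub>R u"] st by simp
    qed (use st in simp)
  qed
qed

end
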